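(* Let $K$ be a $k$-regular graph with $v$ vertices. Let $G$ be a $d$-regular graph having a collection $\mathcal{K}$ of subgraphs isomorphic to $K$ such that each vertex of $G$ is contained in at least $m$ members of $\mathcal{K}$ and each edge of $G$ is contained in at most $t$ members of $\mathcal{K}$. Then $$d+\lambda_{min}(G)\geq (k+\lambda_{min}(K))\cdot \frac{m}{t}.$$
   Context: All graphs are finite and simple. The eigenvalues of a graph are the eigenvalues of its adjacency matrix; $\lambda_{min}(H)$ denotes the smallest eigenvalue of the graph $H$. *)

theory Defs
  imports "Graph_Theory.Graph_Theory" "Jordan_Normal_Form.Spectral_Radius"
begin

text \<open>
  A finite simple graph is a \<^locale>\<open>pair_graph\<close>: finite, loop-free and symmetric, so
  that an undirected edge \<open>uv\<close> is represented by the two arcs \<open>(u, v)\<close> and \<open>(v, u)\<close>.  Hence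
  the degree of a vertex is its out-degree.  As the arcs are pairs of vertices, a
  subgraph is determined by its vertex set and its edge set.
\<close>

definition regular_graph :: "nat \<Rightarrow> 'a pair_pre_digraph \<Rightarrow> bool" where
  "regular_graph d G \<longleftrightarrow> pair_graph G \<and> (\<forall>u \<in> pverts G. out_degree (with_proj G) u = d)"

definition subgraph_isomorphic_to ::
  "'a pair_pre_digraph \<Rightarrow> 'a pair_pre_digraph \<Rightarrow> 'b pair_pre_digraph \<Rightarrow> bool" where
  "subgraph_isomorphic_to H G K \<longleftrightarrow>
     subgraph (with_proj H) (with_proj G) \<and> digraph_iso (with_proj K) (with_proj H)"

definition adjacency_matrix_wrt :: "'a list \<Rightarrow> 'a pair_pre_digraph \<Rightarrow> real mat" where
  "adjacency_matrix_wrt vs G =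
     mat (length vs) (length vs) (\<lambda>(i, j). if (vs ! i, vs ! j) \<in> parcs G then 1 else 0)"

text \<open>
  The rows and columns are indexed through some enumeration of the vertices.  By
  \<open>eigenvalue_adjacency_matrix\<close> below, the eigenvalues do not depend on its choice.
\<close>

definition adjacency_matrix :: "'a pair_pre_digraph \<Rightarrow> real mat" where
  "adjacency_matrix G = adjacency_matrix_wrt (SOME vs. distinct vs \<and> set vs = pverts G) G"

text \<open>
  The adjacency matrix is real symmetric, so all its eigenvalues are real; it therefore suffices to
  take the spectrum over the reals, which is nonempty whenever the graph has a vertex.
\<close>

definition lambda_min :: "'a pair_pre_digraph \<Rightarrow> real" where
  "lambda_min G = Min (spectrum (adjacency_matrix G))"

lemma eigenvalue_adjacency_matrix_wrt:
  assumes vs: "distinct vs" "set vs = pverts G"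
  shows "eigenvalue (adjacency_matrix_wrt vs G) \<mu> \<longleftrightarrow>
    (\<exists>f. (\<exists>u\<in>pverts G. f u \<noteq> 0) \<and>
      (\<forall>u\<in>pverts G. (\<Sum>w\<in>pverts G. if (u, w) \<in> parcs G then f w else 0) = \<mu> * f u))"
    (is "?L \<longleftrightarrow> (\<exists>f. ?R f)")
proof -
  let ?n = "length vs" and ?A = "adjacency_matrix_wrt vs G"
  have bij: "bij_betw ((!) vs) {0..<?n} (pverts G)"
    using bij_betw_nth[OF vs(1), of "{0..<?n}"] vs(2) by (simp add: atLeast0LessThan)
  have mult: "(?A *\<^sub>v vec ?n (\<lambda>i. f (vs ! i))) $ i =
      (\<Sum>w\<in>pverts G. if (vs ! i, w) \<in> parcs G then f w else 0)" if i: "i < ?n" for i f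
  proof -
    have "(?A *\<^sub>v vec ?n (\<lambda>i. f (vs ! i))) $ i =
        (\<Sum>j = 0..<?n. if (vs ! i, vs ! j) \<in> parcs G then f (vs ! j) else 0)"
      using i by (auto simp: adjacency_matrix_wrt_def scalar_prod_def intro!: sum.cong)
    also have "\<dots> = (\<Sum>w\<in>pverts G. if (vs ! i, w) \<in> parcs G then f w else 0)"
      by (rule sum.reindex_bij_betw[OF bij])
    finally show ?thesis .
  qed
  have dims: "dim_row ?A = ?n" by (simp add: adjacency_matrix_wrt_def)
  have vec: "eigenvector ?A (vec ?n (\<lambda>i. f (vs ! i))) \<mu> \<longleftrightarrow> ?R f" for f
  proof -
    have "vec ?n (\<lambda>i. f (vs ! i)) \<noteq> 0\<^sub>v ?n \<longleftrightarrow> (\<exists>u\<in>pverts G. f u \<noteq> 0)"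
      unfolding vs(2)[symmetric] by (fastforce simp: vec_eq_iff in_set_conv_nth)
    moreover have "?A *\<^sub>v vec ?n (\<lambda>i. f (vs ! i)) = \<mu> \<cdot>\<^sub>v vec ?n (\<lambda>i. f (vs ! i)) \<longleftrightarrow>
       (\<forall>i<?n. (?A *\<^sub>v vec ?n (\<lambda>i. f (vs ! i))) $ i = \<mu> * f (vs ! i))"
      by (simp add: vec_eq_iff dims)
    moreover have "\<dots> \<longleftrightarrow>
       (\<forall>u\<in>pverts G. (\<Sum>w\<in>pverts G. if (u, w) \<in> parcs G then f w else 0) = \<mu> * f u)"
      by (simp add: mult all_set_conv_all_nth[of vs, unfolded vs(2)] cong: imp_cong)
    ultimately show ?thesis by (simp add: eigenvector_def dims)
  qed
  have surj: "\<exists>f. v = vec ?n (\<lambda>i. f (vs ! i))" if "v \<in> carrier_vec ?n" for v :: "real vec"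
  proof
    show "v = vec ?n (\<lambda>i. (\<lambda>u. v $ (inv_into {0..<?n} ((!) vs) u)) (vs ! i))"
      using that bij by (simp add: vec_eq_iff bij_betw_def)
  qed
  show ?thesis
  proof
    assume ?L
    then obtain v where v: "eigenvector ?A v \<mu>" by (auto simp: eigenvalue_def)
    then have "v \<in> carrier_vec ?n" by (simp add: eigenvector_def dims)
    from surj[OF this] obtain f where "v = vec ?n (\<lambda>i. f (vs ! i))" ..
    with v vec[of f] show "\<exists>f. ?R f" by blast
  next
    assume "\<exists>f. ?R f"
    then obtain f where "?R f" ..
    with vec[of f] show ?L unfolding eigenvalue_def by blast
  qed
qed

lemma eigenvalue_adjacency_matrix:
  assumes "distinct vs" "set vs = pverts G"
  shows "eigenvalue (adjacency_matrix G) \<mu> \<longleftrightarrow> eigenvalue (adjacency_matrix_wrt vs G) \<mu>"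
proof -
  let ?P = "\<lambda>vs. distinct vs \<and> set vs = pverts G"
  have "?P (SOME vs. ?P vs)"
    by (rule someI[of ?P vs]) (simp add: assms)
  then have "distinct (SOME vs. ?P vs)" "set (SOME vs. ?P vs) = pverts G" by blast+
  from eigenvalue_adjacency_matrix_wrt[OF this] eigenvalue_adjacency_matrix_wrt[OF assms]
  show ?thesis
    unfolding adjacency_matrix_def by (rule trans[OF _ sym])
qed

end

(* Let f be an eigenvector of G for the least eigenvalue.  In a d-regular graph
   (d + lambda) |f|^2 is the sum of (f u + f w)^2 over the edges uw, and t times this sum is at
   least the sum of the same expression over the edges of all copies of K.  On each copy the
   Rayleigh principle for K bounds it below by (k + lambda_min K) |f|^2 restricted to the copy,
   and each vertex of G lies in at least m copies. *)

theory Submission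
  imports Defs "HOL-Analysis.Function_Topology"
begin

section \<open>Rayleigh principle for a real symmetric form on a finite set\<close>

lemma quadratic_nonneg_imp_linear_coeff_zero:
  fixes a b :: real
  assumes "\<And>x. 0 \<le> a * x + b * x\<^sup>2"
  shows "a = 0"
proof (rule ccontr)
  assume "a \<noteq> 0"
  \<comment> \<open>At \<open>x = - a / c\<close> the expression becomes a nonnegative multiple of
    \<open>b - c\<close>. Adding 1 makes \<open>c\<close> both positive and strictly larger than
    \<open>b\<close>, whatever the sign of \<open>b\<close>.\<close>
  define c where "c = \<bar>b\<bar> + 1"
  have "c > 0" "b < c" by (auto simp: c_def)
  have "a * (- a / c) + b * (- a / c)\<^sup>2 = (a\<^sup>2 / c\<^sup>2) * (b - c)"
    using \<open>c > 0\<close> by (simp add: field_simps power2_eq_square)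
  also have "\<dots> < 0"
    using \<open>a \<noteq> 0\<close> \<open>c > 0\<close> \<open>b < c\<close> by (intro mult_pos_neg) auto
  finally show False using assms[of "- a / c"] by simp
qed

text \<open>Pinning the values outside \<open>V\<close> to 0 places the sphere inside a product of
  compact sets, even when the type \<open>'a\<close> is infinite. Tychonoff makes that product
  compact, and the norm condition cuts out a closed subset.\<close>

lemma compact_unit_sphere_finite_support:
  assumes "finite V"
  shows "compact {f :: 'a \<Rightarrow> real. (\<forall>u. u \<notin> V \<longrightarrow> f u = 0) \<and> (\<Sum>u\<in>V. (f u)\<^sup>2) = 1}"
    (is "compact ?S")
proof -
  define B where "B = PiE UNIV (\<lambda>u :: 'a. if u \<in> V then {-1..1 :: real} else {0})"
  have "compactin (product_topology (\<lambda>_. euclidean) UNIV) B"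
    unfolding B_def compactin_PiE by auto
  then have "compact B" by (simp add: euclidean_product_topology)
  moreover have "closed {f :: 'a \<Rightarrow> real. (\<Sum>u\<in>V. (f u)\<^sup>2) = 1}"
    by (intro closed_Collect_eq continuous_intros continuous_on_product_coordinates)
  moreover have "?S = B \<inter> {f. (\<Sum>u\<in>V. (f u)\<^sup>2) = 1}"
  proof -
    have "\<bar>f u\<bar> \<le> 1" if "(\<Sum>u\<in>V. (f u)\<^sup>2) = 1" "u \<in> V" for f :: "'a \<Rightarrow> real" and u
    proof -
      have "(f u)\<^sup>2 \<le> 1"
        using member_le_sum[of u V "\<lambda>u. (f u)\<^sup>2"] that assms by simp
      then show ?thesis by (simp add: abs_square_le_1)
    qed
    then have *: "-1 \<le> f u \<and> f u \<le> 1"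
      if "(\<Sum>u\<in>V. (f u)\<^sup>2) = 1" "u \<in> V" for f :: "'a \<Rightarrow> real" and u
      using that by (fastforce simp: abs_le_iff)
    show ?thesis by (auto simp: B_def PiE_iff * split: if_splits)
  qed
  ultimately show ?thesis by (simp add: compact_Int_closed)
qed

text \<open>By compactness the form attains its minimum on the unit sphere at some \<open>f\<close>,
  and \<open>\<mu>\<close> is that minimum. Scaling extends minimality to the inequality for every
  \<open>g\<close>; vanishing of the first variation at \<open>f\<close> is the eigenvalue
  equation.\<close>

lemma symmetric_form_least_eigenvalue:
  fixes a :: "'a \<Rightarrow> 'a \<Rightarrow> real"
  assumes fin: "finite V" and ne: "V \<noteq> {}"
    and sym: "\<And>u w. u \<in> V \<Longrightarrow> w \<in> V \<Longrightarrow> a u w = a w u"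
  obtains \<mu> f where "\<exists>u\<in>V. f u \<noteq> 0" "\<And>u. u \<in> V \<Longrightarrow> (\<Sum>w\<in>V. a u w * f w) = \<mu> * f u"
    "\<And>g. \<mu> * (\<Sum>u\<in>V. (g u)\<^sup>2) \<le> (\<Sum>u\<in>V. \<Sum>w\<in>V. a u w * g u * g w)"
proof -
  define S where "S = {f :: 'a \<Rightarrow> real. (\<forall>u. u \<notin> V \<longrightarrow> f u = 0) \<and> (\<Sum>u\<in>V. (f u)\<^sup>2) = 1}"
  define Q where "Q g = (\<Sum>u\<in>V. \<Sum>w\<in>V. a u w * g u * g w)" for g
  define N where "N g = (\<Sum>u\<in>V. (g u)\<^sup>2)" for g :: "'a \<Rightarrow> real"
  \<comment> \<open>The indicator of a single point shows that \<open>S\<close> is nonempty, as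
    attaining the infimum requires.\<close>
  obtain u0 where "u0 \<in> V" using ne by blast
  have "(\<lambda>u. if u = u0 then 1 else 0) \<in> S"
    using \<open>u0 \<in> V\<close> fin by (auto simp: S_def if_distrib[of "\<lambda>x. x\<^sup>2"] cong: if_cong)
  moreover have "continuous_on S Q"
    unfolding Q_def
    by (intro continuous_intros continuous_on_subset[OF continuous_on_product_coordinates]) auto
  moreover have "compact S"
    unfolding S_def by (rule compact_unit_sphere_finite_support[OF fin])
  ultimately obtain f where f: "f \<in> S" "\<And>g. g \<in> S \<Longrightarrow> Q f \<le> Q g"
    using continuous_attains_inf[of S Q] by blast
  have Nf: "N f = 1" using f(1) by (simp add: S_def N_def)
  have rayleigh: "Q f * N g \<le> Q g" for g
  proof (cases "N g = 0")
    case True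
    then have "\<And>u. u \<in> V \<Longrightarrow> g u = 0" using fin by (simp add: N_def sum_nonneg_eq_0_iff)
    then show ?thesis using True by (simp add: Q_def)
  next
    case False
    moreover have "N g \<ge> 0" by (simp add: N_def sum_nonneg)
    ultimately have pos: "N g > 0" by simp
    \<comment> \<open>\<open>g\<close> is normalised and also cut off outside \<open>V\<close>, as
      membership in \<open>S\<close> demands; \<open>Q\<close> and \<open>N\<close> see only the
      values on \<open>V\<close>.\<close>
    define h where "h u = (if u \<in> V then g u / sqrt (N g) else 0)" for u
    have "(\<Sum>u\<in>V. (h u)\<^sup>2) = (\<Sum>u\<in>V. (g u)\<^sup>2 / N g)"
      using pos by (intro sum.cong) (auto simp: h_def power_divide)
    also have "\<dots> = 1" using pos by (simp add: sum_divide_distrib[symmetric] N_def)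
    finally have "h \<in> S" by (simp add: S_def h_def)
    moreover have "Q h = (\<Sum>u\<in>V. \<Sum>w\<in>V. a u w * g u * g w / N g)"
      unfolding Q_def using pos by (intro sum.cong) (auto simp: h_def)
    then have "Q h = Q g / N g" by (simp add: Q_def sum_divide_distrib)
    ultimately show ?thesis using f(2)[of h] pos by (simp add: le_divide_eq)
  qed
  \<comment> \<open>\<open>r\<close> is the residual of the eigenvalue equation at \<open>f\<close>.
    Perturbing \<open>f\<close> in the direction \<open>r\<close> makes the linear coefficient
    exactly \<open>2 * N r\<close>, so once that coefficient vanishes, \<open>r\<close> is zero on
    \<open>V\<close>.\<close>
  define r where "r u = (\<Sum>w\<in>V. a u w * f w) - Q f * f u" for u
  have expand: "Q (\<lambda>u. f u + x * r u) - Q f * N (\<lambda>u. f u + x * r u)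
      = 2 * N r * x + (Q r - Q f * N r) * x\<^sup>2" for x
  proof -
    let ?C = "\<Sum>u\<in>V. \<Sum>w\<in>V. a u w * r u * f w"
    \<comment> \<open>Symmetry of \<open>a\<close> identifies the two cross terms of the
      expansion.\<close>
    have "(\<Sum>u\<in>V. \<Sum>w\<in>V. a u w * f u * r w) = ?C"
      by (subst sum.swap) (intro sum.cong, auto simp: sym)
    moreover have "a u w * (f u + x * r u) * (f w + x * r w) = a u w * f u * f w
        + x * (a u w * f u * r w) + x * (a u w * r u * f w) + x\<^sup>2 * (a u w * r u * r w)" for u w
      by (simp add: algebra_simps power2_eq_square)
    ultimately have "Q (\<lambda>u. f u + x * r u) = Q f + 2 * x * ?C + x\<^sup>2 * Q r"
      by (simp add: Q_def sum.distrib sum_distrib_left[symmetric])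
    moreover have "(f u + x * r u)\<^sup>2 = (f u)\<^sup>2 + 2 * x * (r u * f u) + x\<^sup>2 * (r u)\<^sup>2" for u
      by (simp add: algebra_simps power2_eq_square)
    then have "N (\<lambda>u. f u + x * r u) = N f + 2 * x * (\<Sum>u\<in>V. r u * f u) + x\<^sup>2 * N r"
      by (simp add: N_def sum.distrib sum_distrib_left[symmetric])
    moreover have "?C - Q f * (\<Sum>u\<in>V. r u * f u) = N r"
    proof -
      have "?C - Q f * (\<Sum>u\<in>V. r u * f u)
          = (\<Sum>u\<in>V. r u * ((\<Sum>w\<in>V. a u w * f w) - Q f * f u))"
        by (simp add: sum_subtractf[symmetric] sum_distrib_left algebra_simps)
      then show ?thesis by (simp add: r_def[symmetric] N_def power2_eq_square)
    qed
    then have "?C = N r + Q f * (\<Sum>u\<in>V. r u * f u)" by simp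
    ultimately show ?thesis by (simp add: Nf algebra_simps)
  qed
  have "0 \<le> 2 * N r * x + (Q r - Q f * N r) * x\<^sup>2" for x
    unfolding expand[symmetric] using rayleigh by simp
  then have "2 * N r = 0" by (rule quadratic_nonneg_imp_linear_coeff_zero)
  then have "\<And>u. u \<in> V \<Longrightarrow> r u = 0" using fin by (simp add: N_def sum_nonneg_eq_0_iff)
  then have "\<And>u. u \<in> V \<Longrightarrow> (\<Sum>w\<in>V. a u w * f w) = Q f * f u" by (simp add: r_def)
  moreover have "\<exists>u\<in>V. f u \<noteq> 0"
  proof (rule ccontr)
    assume "\<not> (\<exists>u\<in>V. f u \<noteq> 0)"
    then show False using Nf by (simp add: N_def)
  qed
  ultimately show thesis
    using that[of f "Q f"] rayleigh unfolding Q_def N_def by blast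
qed

section \<open>The least adjacency eigenvalue of a graph\<close>

lemma eigenvalue_adjacency_matrix_iff:
  assumes "finite (pverts G)"
  shows "eigenvalue (adjacency_matrix G) \<mu> \<longleftrightarrow>
    (\<exists>f. (\<exists>u\<in>pverts G. f u \<noteq> 0) \<and>
      (\<forall>u\<in>pverts G. (\<Sum>w\<in>pverts G. if (u, w) \<in> parcs G then f w else 0) = \<mu> * f u))"
proof -
  obtain vs where "distinct vs" "set vs = pverts G"
    using finite_distinct_list[OF assms] by blast
  then show ?thesis
    by (simp only: eigenvalue_adjacency_matrix eigenvalue_adjacency_matrix_wrt)
qed

text \<open>Together with nonemptiness of the spectrum this makes the \<open>Min\<close> in
  \<open>lambda_min\<close> a genuine minimum. The matrix is square whichever list the choice
  operator returns.\<close>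

lemma finite_spectrum_adjacency_matrix: "finite (spectrum (adjacency_matrix G))"
  by (rule card_finite_spectrum)
    (unfold adjacency_matrix_def adjacency_matrix_wrt_def, rule mat_carrier)

lemma (in pair_graph) sum_arcs_eq:
  fixes F :: "'a \<Rightarrow> 'a \<Rightarrow> real"
  shows "(\<Sum>(u, w)\<in>parcs G. F u w)
    = (\<Sum>u\<in>pverts G. \<Sum>w\<in>pverts G. if (u, w) \<in> parcs G then F u w else 0)"
proof -
  have "(\<Sum>(u, w)\<in>parcs G. F u w)
      = (\<Sum>e\<in>pverts G \<times> pverts G. if e \<in> parcs G then (case e of (u, w) \<Rightarrow> F u w) else 0)"
    by (rule sum.mono_neutral_cong_left)
      (auto dest: arc_fst_in_verts arc_snd_in_verts)
  also have "\<dots> = (\<Sum>(u, w)\<in>pverts G \<times> pverts G. if (u, w) \<in> parcs G then F u w else 0)"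
    by (intro sum.cong) auto
  finally show ?thesis by (simp only: sum.cartesian_product)
qed

text \<open>The variational minimum \<open>\<mu>\<close> is an eigenvalue, so the spectrum is
  nonempty and \<open>lambda_min G\<close> is attained in it. The bound for \<open>\<mu>\<close>
  passes to \<open>lambda_min G \<le> \<mu>\<close> because the squared norm is nonnegative.\<close>

lemma (in pair_graph)
  assumes "pverts G \<noteq> {}"
  shows eigenvalue_lambda_min: "eigenvalue (adjacency_matrix G) (lambda_min G)"
    and rayleigh_lambda_min:
      "lambda_min G * (\<Sum>u\<in>pverts G. (g u)\<^sup>2) \<le> (\<Sum>(u, w)\<in>parcs G. g u * g w)"
proof -
  define a :: "'a \<Rightarrow> 'a \<Rightarrow> real" where "a u w = (if (u, w) \<in> parcs G then 1 else 0)" for u w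
  have sym: "a u w = a w u" for u w
    using arcs_symmetric by (auto simp: a_def)
  have mult_a: "a u w * x = (if (u, w) \<in> parcs G then x else 0)" for u w x
    by (simp add: a_def)
  obtain \<mu> f where nz: "\<exists>u\<in>pverts G. f u \<noteq> 0"
    and eig: "\<And>u. u \<in> pverts G \<Longrightarrow> (\<Sum>w\<in>pverts G. a u w * f w) = \<mu> * f u"
    and ray: "\<And>g. \<mu> * (\<Sum>u\<in>pverts G. (g u)\<^sup>2)
      \<le> (\<Sum>u\<in>pverts G. \<Sum>w\<in>pverts G. a u w * g u * g w)"
    by (rule symmetric_form_least_eigenvalue[of "pverts G" a,
          OF pair_finite_verts assms sym]) blast
  have "eigenvalue (adjacency_matrix G) \<mu>"
    unfolding eigenvalue_adjacency_matrix_iff[OF pair_finite_verts]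
    using nz eig[unfolded mult_a] by blast
  then have "\<mu> \<in> spectrum (adjacency_matrix G)" by (simp add: spectrum_def)
  then have le: "lambda_min G \<le> \<mu>"
    and "lambda_min G \<in> spectrum (adjacency_matrix G)"
    unfolding lambda_min_def using finite_spectrum_adjacency_matrix[of G]
    by (auto intro: Min_in)
  then show "eigenvalue (adjacency_matrix G) (lambda_min G)" by (simp add: spectrum_def)
  have "lambda_min G * (\<Sum>u\<in>pverts G. (g u)\<^sup>2) \<le> \<mu> * (\<Sum>u\<in>pverts G. (g u)\<^sup>2)"
    by (intro mult_right_mono le sum_nonneg) auto
  also note ray[of g]
  also have "(\<Sum>u\<in>pverts G. \<Sum>w\<in>pverts G. a u w * g u * g w) = (\<Sum>(u, w)\<in>parcs G. g u * g w)"
    unfolding sum_arcs_eq by (intro sum.cong) (auto simp: a_def)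
  finally show "lambda_min G * (\<Sum>u\<in>pverts G. (g u)\<^sup>2) \<le> (\<Sum>(u, w)\<in>parcs G. g u * g w)" .
qed

section \<open>Sums of \<open>(f u + f w)\<^sup>2\<close> over the arcs of a regular graph\<close>

lemma regular_graph_sum_squares:
  fixes f :: "'a \<Rightarrow> real"
  assumes "regular_graph d G"
  shows "(\<Sum>(u, w)\<in>parcs G. (f u + f w)\<^sup>2)
    = 2 * (d * (\<Sum>u\<in>pverts G. (f u)\<^sup>2) + (\<Sum>(u, w)\<in>parcs G. f u * f w))"
proof -
  interpret pair_graph G using assms by (simp add: regular_graph_def)
  \<comment> \<open>Arcs are grouped by their tail; regularity puts \<open>d\<close> arcs in each
    group.\<close>
  have "(\<Sum>(u, w)\<in>parcs G. (f u)\<^sup>2) = (\<Sum>u\<in>pverts G. \<Sum>e\<in>{e \<in> parcs G. fst e = u}. (f (fst e))\<^sup>2)"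
    unfolding case_prod_beta
    by (rule sum.group[symmetric]) (auto dest: arc_fst_in_verts)
  also have "\<dots> = (\<Sum>u\<in>pverts G. d * (f u)\<^sup>2)"
    using assms by (intro sum.cong) (auto simp: regular_graph_def out_degree_def out_arcs_def)
  finally have tails: "(\<Sum>(u, w)\<in>parcs G. (f u)\<^sup>2) = d * (\<Sum>u\<in>pverts G. (f u)\<^sup>2)"
    by (simp add: sum_distrib_left)
  \<comment> \<open>Arc reversal exchanges tails and heads, so both square terms contribute equally.
    The overall factor 2 reflects that every undirected edge is two arcs.\<close>
  have "(\<Sum>(u, w)\<in>parcs G. (f w)\<^sup>2) = (\<Sum>(u, w)\<in>parcs G. (f u)\<^sup>2)"
    by (rule sum.reindex_bij_witness[where i = prod.swap and j = prod.swap])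
      (auto intro: arcs_symmetric)
  with tails show ?thesis
    by (simp add: power2_sum case_prod_beta sum.distrib sum_distrib_left mult.assoc)
qed

text \<open>Shifting the Rayleigh bound by \<open>k\<close> turns the quadratic form into a sum of
  nonnegative terms, one per arc. In this shape bounds for overlapping copies can be added and the
  multiplicities of arcs estimated.\<close>

lemma regular_graph_lambda_min_sum_squares:
  assumes "regular_graph k K" "pverts K \<noteq> {}"
  shows "2 * (k + lambda_min K) * (\<Sum>u\<in>pverts K. (f u)\<^sup>2) \<le> (\<Sum>(u, w)\<in>parcs K. (f u + f w)\<^sup>2)"
proof -
  interpret pair_graph K using assms by (simp add: regular_graph_def)
  show ?thesis
    using rayleigh_lambda_min[OF assms(2), of f]
    by (simp add: regular_graph_sum_squares[OF assms(1)] algebra_simps)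
qed

text \<open>An eigenvector for \<open>lambda_min G\<close> turns the Rayleigh bound into an
  equality. Its positive squared norm can later be cancelled.\<close>

lemma regular_graph_lambda_min_eigenvector:
  assumes "regular_graph d G" "pverts G \<noteq> {}"
  obtains f where "(\<Sum>u\<in>pverts G. (f u)\<^sup>2) > 0"
    "(\<Sum>(u, w)\<in>parcs G. (f u + f w)\<^sup>2) = 2 * (d + lambda_min G) * (\<Sum>u\<in>pverts G. (f u)\<^sup>2)"
proof -
  interpret pair_graph G using assms by (simp add: regular_graph_def)
  obtain f where nz: "\<exists>u\<in>pverts G. f u \<noteq> 0"
    and eig: "\<And>u. u \<in> pverts G \<Longrightarrow>
      (\<Sum>w\<in>pverts G. if (u, w) \<in> parcs G then f w else 0) = lambda_min G * f u"
    using eigenvalue_lambda_min[OF assms(2)]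
    unfolding eigenvalue_adjacency_matrix_iff[OF pair_finite_verts] by blast
  have "(\<Sum>(u, w)\<in>parcs G. f u * f w)
      = (\<Sum>u\<in>pverts G. f u * (\<Sum>w\<in>pverts G. if (u, w) \<in> parcs G then f w else 0))"
    unfolding sum_arcs_eq sum_distrib_left by (intro sum.cong) auto
  also have "\<dots> = (\<Sum>u\<in>pverts G. lambda_min G * (f u)\<^sup>2)"
    by (intro sum.cong) (auto simp: eig power2_eq_square)
  finally have "(\<Sum>(u, w)\<in>parcs G. (f u + f w)\<^sup>2)
      = 2 * (d + lambda_min G) * (\<Sum>u\<in>pverts G. (f u)\<^sup>2)"
    by (simp add: regular_graph_sum_squares[OF assms(1)] sum_distrib_left[symmetric] algebra_simps)
  moreover have "(\<Sum>u\<in>pverts G. (f u)\<^sup>2) > 0"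
    using nz by (auto intro: sum_pos2)
  ultimately show thesis using that by blast
qed

text \<open>At an eigenvector this number times a positive norm is a sum of squares, up to the
  factor 2. The sign allows the lower bound by \<open>m\<close> to be multiplied by
  \<open>k + lambda_min K\<close>.\<close>

lemma regular_graph_lambda_min_ge:
  assumes "regular_graph k K" "pverts K \<noteq> {}"
  shows "0 \<le> k + lambda_min K"
proof -
  obtain f where f: "(\<Sum>u\<in>pverts K. (f u)\<^sup>2) > 0"
    "(\<Sum>(u, w)\<in>parcs K. (f u + f w)\<^sup>2) = 2 * (k + lambda_min K) * (\<Sum>u\<in>pverts K. (f u)\<^sup>2)"
    using regular_graph_lambda_min_eigenvector[OF assms] by metis
  have "0 \<le> (\<Sum>(u, w)\<in>parcs K. (f u + f w)\<^sup>2)" by (intro sum_nonneg) auto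
  with f show ?thesis by (simp add: zero_le_mult_iff)
qed

section \<open>Transfer to the copies of \<open>K\<close> and double counting\<close>

lemma subgraph_isomorphic_sum_squares:
  assumes "regular_graph k K" "pverts K \<noteq> {}" "subgraph_isomorphic_to H G K"
  shows "2 * (k + lambda_min K) * (\<Sum>u\<in>pverts H. (f u)\<^sup>2) \<le> (\<Sum>(u, w)\<in>parcs H. (f u + f w)\<^sup>2)"
proof -
  obtain h where iso: "pre_digraph.digraph_isomorphism (with_proj K) h"
    and H: "with_proj H = app_iso h (with_proj K)"
    using assms(3) by (auto simp: subgraph_isomorphic_to_def digraph_iso_def)
  \<comment> \<open>As \<open>H\<close> is also a graph on pairs, the tail and head maps of the
    image digraph must be the projections. Hence \<open>iso_arcs h\<close> sends an arc to the pair
    of the images of its ends.\<close>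
  have verts: "pverts H = iso_verts h ` pverts K" and arcs: "parcs H = iso_arcs h ` parcs K"
    and ends: "iso_tail h = fst" "iso_head h = snd"
    using arg_cong[OF H, of verts] arg_cong[OF H, of arcs]
      arg_cong[OF H, of tail] arg_cong[OF H, of head] by simp_all
  have inj: "inj_on (iso_verts h) (pverts K)" "inj_on (iso_arcs h) (parcs K)"
    and arc: "\<And>e. e \<in> parcs K \<Longrightarrow> fst (iso_arcs h e) = iso_verts h (fst e)"
      "\<And>e. e \<in> parcs K \<Longrightarrow> snd (iso_arcs h e) = iso_verts h (snd e)"
    using iso by (auto simp: pre_digraph.digraph_isomorphism_def ends)
  have "(\<Sum>(u, w)\<in>parcs H. (f u + f w)\<^sup>2)
      = (\<Sum>(u, w)\<in>parcs K. (f (iso_verts h u) + f (iso_verts h w))\<^sup>2)"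
    unfolding arcs by (simp add: sum.reindex inj arc case_prod_beta cong: sum.cong)
  moreover have "(\<Sum>u\<in>pverts H. (f u)\<^sup>2) = (\<Sum>u\<in>pverts K. (f (iso_verts h u))\<^sup>2)"
    unfolding verts by (simp add: sum.reindex inj)
  \<comment> \<open>The bound is applied to \<open>K\<close> itself, with \<open>f\<close> pulled
    back along the isomorphism.\<close>
  ultimately show ?thesis
    using regular_graph_lambda_min_sum_squares[OF assms(1,2), of "f \<circ> iso_verts h"] by simp
qed

text \<open>Double counting of the incidences between indices and elements. It serves both for
  vertices in copies and for arcs in copies.\<close>

lemma sum_sum_eq_sum_card:
  fixes F :: "'a \<Rightarrow> real"
  assumes "finite I" "finite E" "\<And>i. i \<in> I \<Longrightarrow> A i \<subseteq> E"
  shows "(\<Sum>i\<in>I. \<Sum>e\<in>A i. F e) = (\<Sum>e\<in>E. card {i \<in> I. e \<in> A i} * F e)"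
proof -
  have "(\<Sum>i\<in>I. \<Sum>e\<in>A i. F e) = (\<Sum>i\<in>I. \<Sum>e | e \<in> E \<and> e \<in> A i. F e)"
    using assms(3) by (intro sum.cong) auto
  also have "\<dots> = (\<Sum>e\<in>E. \<Sum>i | i \<in> I \<and> e \<in> A i. F e)"
    using assms(1,2) by (rule sum.swap_restrict)
  finally show ?thesis by simp
qed

theorem theorem1p1:
  fixes K :: "'b pair_pre_digraph" and G :: "'a pair_pre_digraph"
    and \<K> :: "'a pair_pre_digraph set"
    and k v d m t :: nat
  assumes "regular_graph k K" and "card (pverts K) = v" and "pverts K \<noteq> {}"
    and "regular_graph d G" and "pverts G \<noteq> {}"
    and "\<And>H. H \<in> \<K> \<Longrightarrow> subgraph_isomorphic_to H G K"
    and "\<And>u. u \<in> pverts G \<Longrightarrow> m \<le> card {H \<in> \<K>. u \<in> pverts H}"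
    and "\<And>e. e \<in> parcs G \<Longrightarrow> card {H \<in> \<K>. e \<in> parcs H} \<le> t"
    and "0 < t"
  shows "real d + lambda_min G \<ge> (real k + lambda_min K) * (real m / real t)"
proof -
  interpret pair_graph G using assms(4) by (simp add: regular_graph_def)
  let ?c = "real k + lambda_min K"
  have sub: "pverts H \<subseteq> pverts G" "parcs H \<subseteq> parcs G" if "H \<in> \<K>" for H
    using assms(6)[OF that] by (auto simp: subgraph_isomorphic_to_def subgraph_def)
  \<comment> \<open>A member of \<open>\<K>\<close> is determined by its vertex set and arc set,
    both subsets of finite sets, so \<open>\<K>\<close> is finite and sums over it can be
    exchanged.\<close>
  have "inj_on (\<lambda>H. (pverts H, parcs H)) \<K>"
    by (intro inj_onI) (simp add: pair_pre_digraph.equality)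
  moreover have "(\<lambda>H. (pverts H, parcs H)) ` \<K> \<subseteq> Pow (pverts G) \<times> Pow (parcs G)"
    using sub by auto
  ultimately have fin: "finite \<K>"
    by (rule inj_on_finite) (simp add: pair_finite_verts pair_finite_arcs)
  obtain f where f: "(\<Sum>u\<in>pverts G. (f u)\<^sup>2) > 0"
    "(\<Sum>(u, w)\<in>parcs G. (f u + f w)\<^sup>2) = 2 * (d + lambda_min G) * (\<Sum>u\<in>pverts G. (f u)\<^sup>2)"
    using regular_graph_lambda_min_eigenvector[OF assms(4,5)] by metis
  let ?N = "\<Sum>u\<in>pverts G. (f u)\<^sup>2"
  have "m * ?N \<le> (\<Sum>u\<in>pverts G. card {H \<in> \<K>. u \<in> pverts H} * (f u)\<^sup>2)"
    unfolding sum_distrib_left using assms(7) by (intro sum_mono mult_right_mono) auto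
  also have "\<dots> = (\<Sum>H\<in>\<K>. \<Sum>u\<in>pverts H. (f u)\<^sup>2)"
    by (rule sum_sum_eq_sum_card[OF fin pair_finite_verts sub(1), symmetric])
  finally have "2 * ?c * (m * ?N) \<le> 2 * ?c * (\<Sum>H\<in>\<K>. \<Sum>u\<in>pverts H. (f u)\<^sup>2)"
    using regular_graph_lambda_min_ge[OF assms(1,3)] by (intro mult_left_mono) auto
  also have "\<dots> = (\<Sum>H\<in>\<K>. 2 * ?c * (\<Sum>u\<in>pverts H. (f u)\<^sup>2))"
    by (rule sum_distrib_left)
  also have "\<dots> \<le> (\<Sum>H\<in>\<K>. \<Sum>(u, w)\<in>parcs H. (f u + f w)\<^sup>2)"
    by (intro sum_mono subgraph_isomorphic_sum_squares[OF assms(1,3,6)])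
  also have "\<dots> = (\<Sum>e\<in>parcs G. card {H \<in> \<K>. e \<in> parcs H} * (case e of (u, w) \<Rightarrow> (f u + f w)\<^sup>2))"
    by (rule sum_sum_eq_sum_card[OF fin pair_finite_arcs sub(2)])
  \<comment> \<open>Every weight is a square, so the multiplicity of each arc may be raised to
    \<open>t\<close>.\<close>
  also have "\<dots> \<le> (\<Sum>e\<in>parcs G. t * (case e of (u, w) \<Rightarrow> (f u + f w)\<^sup>2))"
    using assms(8) by (intro sum_mono mult_right_mono) (auto split: prod.splits)
  also have "\<dots> = 2 * (t * (d + lambda_min G)) * ?N"
    by (simp add: sum_distrib_left[symmetric] f(2))
  finally have "(2 * (?c * m)) * ?N \<le> (2 * (t * (d + lambda_min G))) * ?N"
    by (simp only: mult.assoc)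
  \<comment> \<open>The positive factor \<open>2 * ?N\<close> is cancelled.\<close>
  then have "?c * m \<le> t * (d + lambda_min G)"
    using f(1) by simp
  then show ?thesis using assms(9) by (simp add: field_simps)
qed

end
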